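(* Let $G=(V,E)$ be a finite connected undirected graph with an arbitrarily chosen orientation of each edge, let $(G,\mathcal{M})$ be a sheaf of means on $G$ with stalk dimension $d$ and invertible restriction maps $\mathcal{M}_{v\unlhd e}\in\mathbb{R}^{d\times d}$, and let $(G,\mathcal{C})$ be the associated sheaf of covariances, with Laplacian $L_{\mathcal{C}}=L_{\mathcal{C}}^++L_{\mathcal{C}}^-$. Then $$\operatorname{Eq}(L_{\mathcal{C}}^+,L_{\mathcal{C}}^-)=H^0(G,\mathcal{C}),$$ where $\operatorname{Eq}(L_{\mathcal{C}}^+,L_{\mathcal{C}}^-)=\{\Sigma\in C^0(G,\mathcal{C}):L_{\mathcal{C}}^+(\Sigma)=L_{\mathcal{C}}^-(\Sigma)\}$.
   Context: Let $\mathcal{S}_+^d$ be the cone of symmetric positive semidefinite $d\times d$ real matrices. For a real matrix $A$ write $\varphi_A(\Sigma)=A\Sigma A^\top$. Write $v\unlhd e$ when $v$ is an endpoint of $e$, and $n=|V|$. Sheaf of means $(G,\mathcal{M})$ with stalk dimension $d$: assigns the vector space $\mathbb{R}^d$ to every vertex and every edge, and a matrix $\mathcal{M}_{v\unlhd e}\in\mathbb{R}^{d\times d}$ to every incident pair $v\unlhd e$. Its coboundary operator $\delta_{\mathcal{M}}:\mathbb{R}^{nd}\to\mathbb{R}^{|E|d}$ is, for an edge oriented as $e=(v,u)$, $(\delta_{\mathcal{M}}\mu)_e=\mathcal{M}_{v\unlhd e}\mu_v-\mathcal{M}_{u\unlhd e}\mu_u$. It is decomposed as $\delta_{\mathcal{M}}=\delta_{\mathcal{M}}^+-\delta_{\mathcal{M}}^-$,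 where $(\delta_{\mathcal{M}}^+\mu)_e=\mathcal{M}_{v\unlhd e}\mu_v$ and $(\delta_{\mathcal{M}}^-\mu)_e=\mathcal{M}_{u\unlhd e}\mu_u$. Sheaf of covariances $(G,\mathcal{C})$ associated with $(G,\mathcal{M})$: assigns $\mathcal{S}_+^d$ to every vertex and every edge, with restriction maps $\mathcal{C}_{v\unlhd e}=\varphi_{\mathcal{M}_{v\unlhd e}}$. Its spaces of cochains $C^0(G,\mathcal{C})=\bigoplus_{v\in V}\mathcal{S}_+^d$ and $C^1(G,\mathcal{C})=\bigoplus_{e\in E}\mathcal{S}_+^d$ are the cones of block-diagonal positive semidefinite matrices with diagonal $d\times d$ blocks indexed by $V$, respectively $E$. Let $\mathbf{A}_j=(\mathbf{e}_j\mathbf{e}_j^\top)\otimes I_d\in\mathbb{R}^{|E|d\times|E|d}$ for $1\le j\le|E|$ and $\mathbf{B}_i=(\mathbf{e}_i\mathbf{e}_i^\top)\otimes I_d\in\mathbb{R}^{nd\times nd}$ for $1\le i\le n$, with $\mathbf{e}_j$, $\mathbf{e}_i$ standard basis vectors of $\mathbb{R}^{|E|}$, $\mathbb{R}^n$ respectively. Define $\delta_{\mathcal{C}}^{\pm}(\Sigma)=\sum_j\varphi_{\mathbf{A}_j}(\varphi_{\delta_{\mathcal{M}}^{\pm}}(\Sigma))$ for $\Sigma\in C^0(G,\mathcal{C})$, and $\delta_{\mathcal{C}}=\delta_{\mathcal{C}}^++\delta_{\mathcal{C}}^-$. The zeroth cohomology is the equalizer $H^0(G,\mathcal{C})=\{\Sigma\in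 C^0(G,\mathcal{C}):\delta_{\mathcal{C}}^+(\Sigma)=\delta_{\mathcal{C}}^-(\Sigma)\}$. The sheaf Laplacian $L_{\mathcal{C}}:C^0(G,\mathcal{C})\to C^0(G,\mathcal{C})$ is $L_{\mathcal{C}}(\Sigma)=\sum_{i=1}^n\varphi_{\mathbf{B}_i}\big(\varphi_{(\delta_{\mathcal{M}}^+)^\top}(\delta_{\mathcal{C}}(\Sigma))+\varphi_{(\delta_{\mathcal{M}}^-)^\top}(\delta_{\mathcal{C}}(\Sigma))\big)$. It decomposes as $L_{\mathcal{C}}=L_{\mathcal{C}}^++L_{\mathcal{C}}^-$ with $$L_{\mathcal{C}}^+(\Sigma)=\sum_{i,j}\varphi_{\mathbf{B}_i}\big(\varphi_{(\delta_{\mathcal{M}}^+)^\top\mathbf{A}_j\delta_{\mathcal{M}}^+}(\Sigma)+\varphi_{(\delta_{\mathcal{M}}^-)^\top\mathbf{A}_j\delta_{\mathcal{M}}^-}(\Sigma)\big),$$ $$L_{\mathcal{C}}^-(\Sigma)=\sum_{i,j}\varphi_{\mathbf{B}_i}\big(\varphi_{(\delta_{\mathcal{M}}^+)^\top\mathbf{A}_j\delta_{\mathcal{M}}^-}(\Sigma)+\varphi_{(\delta_{\mathcal{M}}^-)^\top\mathbf{A}_j\delta_{\mathcal{M}}^+}(\Sigma)\big).$$ *)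

theory Defs
  imports "Graph_Theory.Graph_Theory" "Jordan_Normal_Form.Matrix"
begin

text \<open>
  Matrices are those of \<open>Jordan_Normal_Form\<close>, whose dimensions are natural numbers. A matrix with
  \<open>N\<close> block rows of height \<open>d\<close> has \<open>N * d\<close> rows; entry \<open>k\<close> of block \<open>i\<close> sits at position
  \<open>i * d + k\<close>, so position \<open>r\<close> belongs to block \<open>r div d\<close> and has offset \<open>r mod d\<close> in it.
  All indices start at 0.
\<close>

definition psd_cone :: "nat \<Rightarrow> real mat set" where
  "psd_cone d = {S \<in> carrier_mat d d. transpose_mat S = S \<and>
     (\<forall>x \<in> carrier_vec d. 0 \<le> x \<bullet> (S *\<^sub>v x))}"

definition congruence :: "real mat \<Rightarrow> real mat \<Rightarrow> real mat" ("\<phi>") where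
  "\<phi> A S = A * S * transpose_mat A"

abbreviation mat_sum :: "nat \<Rightarrow> ('i \<Rightarrow> real mat) \<Rightarrow> 'i set \<Rightarrow> real mat" where
  "mat_sum N \<equiv> finsum (module_mat TYPE(real) N N)"

lemma mat_sum_carrier:
  assumes "finite I" "\<And>i. i \<in> I \<Longrightarrow> f i \<in> carrier_mat N N"
  shows "mat_sum N f I \<in> carrier_mat N N"
proof -
  interpret abelian_group "module_mat TYPE(real) N N" by (rule abelian_group_mat)
  show ?thesis using finsum_closed[of f I] assms by (auto simp: module_mat_simps)
qed

lemma mat_sum_insert:
  assumes "finite I" "a \<notin> I" "\<And>i. i \<in> insert a I \<Longrightarrow> f i \<in> carrier_mat N N"
  shows "mat_sum N f (insert a I) = f a + mat_sum N f I"
proof -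
  interpret abelian_group "module_mat TYPE(real) N N" by (rule abelian_group_mat)
  show ?thesis using assms by (subst finsum_insert) (auto simp: module_mat_simps)
qed

lemma mat_sum_empty: "mat_sum N f {} = 0\<^sub>m N N"
proof -
  interpret abelian_group "module_mat TYPE(real) N N" by (rule abelian_group_mat)
  show ?thesis by (simp add: module_mat_simps)
qed

lemma mat_sum_index:
  assumes "finite I" "\<And>i. i \<in> I \<Longrightarrow> f i \<in> carrier_mat N N" "r < N" "c < N"
  shows "mat_sum N f I $$ (r, c) = (\<Sum>i\<in>I. f i $$ (r, c))"
  using assms(1,2)
proof (induction I)
  case empty
  then show ?case using assms by (simp add: mat_sum_empty)
next
  case (insert a I)
  have "mat_sum N f I \<in> carrier_mat N N"
    using insert by (intro mat_sum_carrier) auto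
  moreover have "mat_sum N f (insert a I) = f a + mat_sum N f I"
    using insert by (intro mat_sum_insert) auto
  ultimately show ?case using insert assms by simp
qed

definition kronecker :: "real mat \<Rightarrow> real mat \<Rightarrow> real mat" where
  "kronecker A B = mat (dim_row A * dim_row B) (dim_col A * dim_col B)
     (\<lambda>(r, c). A $$ (r div dim_row B, c div dim_col B) * B $$ (r mod dim_row B, c mod dim_col B))"

text \<open>The matrix \<open>(e\<^sub>i e\<^sub>i\<^sup>T) \<otimes> I\<^sub>d\<close>, with \<open>e\<^sub>i\<close> the standard basis vector of \<open>\<real>\<^sup>N\<close>.\<close>

definition block_proj :: "nat \<Rightarrow> nat \<Rightarrow> nat \<Rightarrow> real mat" where
  "block_proj d N i =
     kronecker (mat_of_cols N [unit_vec N i] * mat_of_rows N [unit_vec N i]) (1\<^sub>m d)"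

lemma block_proj_carrier: "block_proj d N i \<in> carrier_mat (N * d) (N * d)"
  by (simp add: block_proj_def kronecker_def)

lemma block_proj_index:
  assumes "r < N * d" "c < N * d"
  shows "block_proj d N i $$ (r, c) = (if r = c \<and> r div d = i then 1 else 0)"
proof -
  have d: "d > 0" using assms by (cases d) auto
  have rc: "r div d < N" "c div d < N" using assms by (auto simp: less_mult_imp_div_less)
  have "r = c \<longleftrightarrow> r div d = c div d \<and> r mod d = c mod d"
    by (metis div_mult_mod_eq)
  with rc d show ?thesis using assms
    by (auto simp: block_proj_def kronecker_def scalar_prod_def mat_of_cols_def mat_of_rows_def unit_vec_def)
qed

text \<open>The cone \<open>\<Oplus>\<^bsub>i<N\<^esub> S\<^sub>+\<^sup>d\<close> of block-diagonal positive semidefinite matrices.\<close>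

definition block_cone :: "nat \<Rightarrow> nat \<Rightarrow> real mat set" where
  "block_cone d N = {diag_block_mat (map X [0..<N]) | X. \<forall>i<N. X i \<in> psd_cone d}"

definition equalizer :: "'a set \<Rightarrow> ('a \<Rightarrow> 'b) \<Rightarrow> ('a \<Rightarrow> 'b) \<Rightarrow> 'a set" where
  "equalizer C f g = {x \<in> C. f x = g x}"


lemma congruence_carrier:
  "X \<in> carrier_mat p q \<Longrightarrow> S \<in> carrier_mat q q \<Longrightarrow> \<phi> X S \<in> carrier_mat p p"
  unfolding congruence_def by auto

lemma congruence_add:
  assumes "X \<in> carrier_mat p q" "S \<in> carrier_mat q q" "T \<in> carrier_mat q q"
  shows "\<phi> X (S + T) = \<phi> X S + \<phi> X T"
proof -
  have "X * (S + T) = X * S + X * T"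
    using assms by (simp add: mult_add_distrib_mat)
  moreover have "(X * S + X * T) * transpose_mat X = X * S * transpose_mat X + X * T * transpose_mat X"
    by (rule add_mult_distrib_mat[of _ p q]) (use assms in auto)
  ultimately show ?thesis by (simp add: congruence_def)
qed

lemma congruence_congruence:
  assumes "X \<in> carrier_mat p q" "Y \<in> carrier_mat q r" "S \<in> carrier_mat r r"
  shows "\<phi> X (\<phi> Y S) = \<phi> (X * Y) S"
proof -
  have t: "transpose_mat (X * Y) = transpose_mat Y * transpose_mat X"
    using assms by (simp add: transpose_mult)
  have "X * (Y * S * transpose_mat Y) * transpose_mat X = X * Y * S * (transpose_mat Y * transpose_mat X)"
    using assms
    by (smt (verit) assoc_mult_mat mult_carrier_mat transpose_carrier_mat)
  then show ?thesis by (simp add: congruence_def t)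
qed

lemma congruence_sum:
  assumes "X \<in> carrier_mat p q" "finite I" "\<And>i. i \<in> I \<Longrightarrow> f i \<in> carrier_mat q q"
  shows "\<phi> X (mat_sum q f I) = mat_sum p (\<lambda>i. \<phi> X (f i)) I"
  using assms(2,3)
proof (induction I)
  case empty
  then show ?case using assms(1) by (simp add: mat_sum_empty congruence_def)
next
  case (insert a I)
  then show ?case using assms(1)
    by (subst (1 2) mat_sum_insert)
      (auto simp: congruence_add[of X p q] mat_sum_carrier congruence_carrier)
qed


text \<open>
  A finite simple undirected graph is a \<open>pair_graph\<close>, i.e. a finite symmetric loop-free digraph
  without parallel arcs; its undirected edges are the two-element sets \<open>{u, v}\<close> with \<open>(u, v)\<close>
  (equivalently \<open>(v, u)\<close>) an arc.
\<close>

definition edges :: "'v pair_pre_digraph \<Rightarrow> 'v set set" where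
  "edges G = {{u, v} | u v. (u, v) \<in> parcs G}"

abbreviation endpoints :: "'v \<times> 'v \<Rightarrow> 'v set" where
  "endpoints a \<equiv> {fst a, snd a}"

definition vertex_enumeration :: "'v pair_pre_digraph \<Rightarrow> 'v list \<Rightarrow> bool" where
  "vertex_enumeration G vs \<longleftrightarrow> distinct vs \<and> set vs = pverts G"

text \<open>Every undirected edge is listed exactly once, as an ordered pair of its endpoints.\<close>

definition oriented_edge_enumeration :: "'v pair_pre_digraph \<Rightarrow> ('v \<times> 'v) list \<Rightarrow> bool" where
  "oriented_edge_enumeration G es \<longleftrightarrow>
     distinct (map endpoints es) \<and> set (map endpoints es) = edges G"

text \<open>
  A sheaf of means with stalk dimension \<open>d\<close> is given by its restriction maps: \<open>M v e\<close> is the matrix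
  for the endpoint \<open>v\<close> of the undirected edge \<open>e\<close>.
\<close>

definition sheaf_of_means ::
    "'v pair_pre_digraph \<Rightarrow> nat \<Rightarrow> ('v \<Rightarrow> 'v set \<Rightarrow> real mat) \<Rightarrow> bool" where
  "sheaf_of_means G d M \<longleftrightarrow> (\<forall>e \<in> edges G. \<forall>v \<in> e. M v e \<in> carrier_mat d d)"

definition invertible_restrictions ::
    "'v pair_pre_digraph \<Rightarrow> ('v \<Rightarrow> 'v set \<Rightarrow> real mat) \<Rightarrow> bool" where
  "invertible_restrictions G M \<longleftrightarrow> (\<forall>e \<in> edges G. \<forall>v \<in> e. invertible_mat (M v e))"


lemma block_index_less:
  assumes "i < N" "k < (d :: nat)"
  shows "i * d + k < N * d"
proof -
  have "Suc i * d \<le> N * d" using assms by (intro mult_le_mono1) simp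
  with assms show ?thesis by simp
qed

context
  fixes vs :: "'v list" and es :: "('v \<times> 'v) list"
    and d :: nat and M :: "'v \<Rightarrow> 'v set \<Rightarrow> real mat"
begin

text \<open>
  The matrix of the map \<open>\<real>\<^sup>n\<^sup>d \<rightarrow> \<real>\<^sup>m\<^sup>d\<close> sending \<open>\<mu>\<close> to the family with \<open>e\<close>-component \<open>M w e *\<^sub>v \<mu>\<^sub>w\<close>,
  where \<open>w = side e\<close> is a chosen endpoint of \<open>e\<close>.
\<close>

definition half_coboundary :: "('v \<times> 'v \<Rightarrow> 'v) \<Rightarrow> real mat" where
  "half_coboundary side = mat (length es * d) (length vs * d)
     (\<lambda>(r, c). let e = es ! (r div d); w = vs ! (c div d) in
        if side e = w then M w (endpoints e) $$ (r mod d, c mod d) else 0)"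

lemma half_coboundary_carrier: "half_coboundary side \<in> carrier_mat (length es * d) (length vs * d)"
  by (simp add: half_coboundary_def)

definition delta_M_plus :: "real mat" ("\<delta>\<^sub>M\<^sup>+") where
  "\<delta>\<^sub>M\<^sup>+ = half_coboundary fst"

definition delta_M_minus :: "real mat" ("\<delta>\<^sub>M\<^sup>-") where
  "\<delta>\<^sub>M\<^sup>- = half_coboundary snd"

definition delta_M :: "real mat" where
  "delta_M = \<delta>\<^sub>M\<^sup>+ - \<delta>\<^sub>M\<^sup>-"

lemma half_coboundary_apply:
  assumes "distinct vs" "\<mu> \<in> carrier_vec (length vs * d)"
    and "j < length es" "k < d" "i < length vs" "side (es ! j) = vs ! i"
    and "M (vs ! i) (endpoints (es ! j)) \<in> carrier_mat d d"
  shows "(half_coboundary side *\<^sub>v \<mu>) $ (j * d + k) =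
    (M (vs ! i) (endpoints (es ! j)) *\<^sub>v vec d (\<lambda>l. \<mu> $ (i * d + l))) $ k"
proof -
  let ?R = "M (vs ! i) (endpoints (es ! j))"
  have jk: "j * d + k < length es * d"
    using assms(3,4) by (rule block_index_less)
  define f where "f c = half_coboundary side $$ (j * d + k, c) * \<mu> $ c" for c
  have f: "f (i' * d + l) = (if i' = i then ?R $$ (k, l) * \<mu> $ (i * d + l) else 0)"
    if "i' < length vs" "l < d" for i' l
  proof -
    have "i' * d + l < length vs * d"
      using that by (rule block_index_less)
    then show ?thesis
      using that assms jk by (auto simp: f_def half_coboundary_def Let_def nth_eq_iff_index_eq)
  qed
  have "(half_coboundary side *\<^sub>v \<mu>) $ (j * d + k) = (\<Sum>c<length vs * d. f c)"
    using jk assms(2) half_coboundary_carrier[of side]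
    by (auto simp: scalar_prod_def f_def lessThan_atLeast0 intro!: sum.cong)
  also have "\<dots> = (\<Sum>i'<length vs. \<Sum>l<d. f (i' * d + l))"
  proof -
    have "sum f {i' * d..<i' * d + d} = (\<Sum>l<d. f (i' * d + l))" for i'
      by (rule sum.reindex_bij_witness[of _ "\<lambda>l. i' * d + l" "\<lambda>c. c - i' * d"]) auto
    then show ?thesis by (simp add: sum.nat_group[symmetric])
  qed
  also have "\<dots> = (\<Sum>i'<length vs. if i' = i then \<Sum>l<d. ?R $$ (k, l) * \<mu> $ (i * d + l) else 0)"
    by (intro sum.cong) (auto simp: f)
  also have "\<dots> = (\<Sum>l<d. ?R $$ (k, l) * \<mu> $ (i * d + l))"
    using assms by simp
  also have "\<dots> = (?R *\<^sub>v vec d (\<lambda>l. \<mu> $ (i * d + l))) $ k"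
    using assms by (auto simp: scalar_prod_def lessThan_atLeast0 intro!: sum.cong)
  finally show ?thesis .
qed

abbreviation (input) edge_proj :: "nat \<Rightarrow> real mat" where
  "edge_proj \<equiv> block_proj d (length es)"

abbreviation (input) vertex_proj :: "nat \<Rightarrow> real mat" where
  "vertex_proj \<equiv> block_proj d (length vs)"

definition C0 :: "real mat set" where
  "C0 = block_cone d (length vs)"

definition delta_C_plus :: "real mat \<Rightarrow> real mat" where
  "delta_C_plus S = mat_sum (length es * d) (\<lambda>j. \<phi> (edge_proj j) (\<phi> \<delta>\<^sub>M\<^sup>+ S)) {..<length es}"

definition delta_C_minus :: "real mat \<Rightarrow> real mat" where
  "delta_C_minus S = mat_sum (length es * d) (\<lambda>j. \<phi> (edge_proj j) (\<phi> \<delta>\<^sub>M\<^sup>- S)) {..<length es}"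

definition delta_C :: "real mat \<Rightarrow> real mat" where
  "delta_C S = delta_C_plus S + delta_C_minus S"

definition H0 :: "real mat set" where
  "H0 = equalizer C0 delta_C_plus delta_C_minus"

definition L_C :: "real mat \<Rightarrow> real mat" where
  "L_C S = mat_sum (length vs * d)
     (\<lambda>i. \<phi> (vertex_proj i) (\<phi> (transpose_mat \<delta>\<^sub>M\<^sup>+) (delta_C S) + \<phi> (transpose_mat \<delta>\<^sub>M\<^sup>-) (delta_C S)))
     {..<length vs}"

definition L_C_plus :: "real mat \<Rightarrow> real mat" where
  "L_C_plus S = mat_sum (length vs * d)
     (\<lambda>(i, j). \<phi> (vertex_proj i) (\<phi> (transpose_mat \<delta>\<^sub>M\<^sup>+ * edge_proj j * \<delta>\<^sub>M\<^sup>+) S + \<phi> (transpose_mat \<delta>\<^sub>M\<^sup>- * edge_proj j * \<delta>\<^sub>M\<^sup>-) S))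
     ({..<length vs} \<times> {..<length es})"

definition L_C_minus :: "real mat \<Rightarrow> real mat" where
  "L_C_minus S = mat_sum (length vs * d)
     (\<lambda>(i, j). \<phi> (vertex_proj i) (\<phi> (transpose_mat \<delta>\<^sub>M\<^sup>+ * edge_proj j * \<delta>\<^sub>M\<^sup>-) S + \<phi> (transpose_mat \<delta>\<^sub>M\<^sup>- * edge_proj j * \<delta>\<^sub>M\<^sup>+) S))
     ({..<length vs} \<times> {..<length es})"

lemma decomposition_of_L_C:
  assumes S: "S \<in> carrier_mat (length vs * d) (length vs * d)"
  shows "L_C S = L_C_plus S + L_C_minus S"
proof -
  let ?n = "length vs * d" and ?m = "length es * d"
  have P: "\<delta>\<^sub>M\<^sup>+ \<in> carrier_mat ?m ?n" and Q: "\<delta>\<^sub>M\<^sup>- \<in> carrier_mat ?m ?n"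
    by (simp_all add: delta_M_plus_def delta_M_minus_def half_coboundary_def)
  have A: "edge_proj j \<in> carrier_mat ?m ?m" and B: "vertex_proj i \<in> carrier_mat ?n ?n" for i j
    by (rule block_proj_carrier)+
  have half: "\<phi> (transpose_mat X) (mat_sum ?m (\<lambda>j. \<phi> (edge_proj j) (\<phi> Y S)) {..<length es})
      = mat_sum ?n (\<lambda>j. \<phi> (transpose_mat X * edge_proj j * Y) S) {..<length es}"
    if X: "X \<in> carrier_mat ?m ?n" and Y: "Y \<in> carrier_mat ?m ?n" for X Y
  proof -
    have "\<phi> (transpose_mat X) (\<phi> (edge_proj j) (\<phi> Y S)) = \<phi> (transpose_mat X * edge_proj j * Y) S" for j
    proof -
      have "\<phi> (transpose_mat X) (\<phi> (edge_proj j) (\<phi> Y S)) = \<phi> (transpose_mat X * edge_proj j) (\<phi> Y S)"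
        by (rule congruence_congruence[of _ ?n ?m _ ?m]) (use X in \<open>auto intro!: A congruence_carrier[OF Y S]\<close>)
      also have "\<dots> = \<phi> (transpose_mat X * edge_proj j * Y) S"
        by (rule congruence_congruence[of _ ?n ?m _ ?n]) (use X Y A S in auto)
      finally show ?thesis .
    qed
    moreover have "\<phi> (transpose_mat X) (mat_sum ?m (\<lambda>j. \<phi> (edge_proj j) (\<phi> Y S)) {..<length es})
      = mat_sum ?n (\<lambda>j. \<phi> (transpose_mat X) (\<phi> (edge_proj j) (\<phi> Y S))) {..<length es}"
      by (rule congruence_sum) (use X in \<open>auto intro!: congruence_carrier[OF A] congruence_carrier[OF Y S]\<close>)
    ultimately show ?thesis by simp
  qed
  define F where "F X Y j = \<phi> (transpose_mat X * edge_proj j * Y) S" for X Y j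
  have F: "F X Y j \<in> carrier_mat ?n ?n"
    if "X \<in> carrier_mat ?m ?n" "Y \<in> carrier_mat ?m ?n" for X Y j
    unfolding F_def using that A[of j] S by (intro congruence_carrier[of _ ?n ?n]) auto
  note Fs = F[OF P P] F[OF P Q] F[OF Q P] F[OF Q Q]
  have dp: "delta_C_plus S \<in> carrier_mat ?m ?m" and dm: "delta_C_minus S \<in> carrier_mat ?m ?m"
    unfolding delta_C_plus_def delta_C_minus_def
    by (auto intro!: mat_sum_carrier congruence_carrier[OF A] congruence_carrier[OF P S] congruence_carrier[OF Q S])
  have h: "\<phi> (transpose_mat X) (delta_C S)
      = mat_sum ?n (F X \<delta>\<^sub>M\<^sup>+) {..<length es} + mat_sum ?n (F X \<delta>\<^sub>M\<^sup>-) {..<length es}"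
    if X: "X \<in> carrier_mat ?m ?n" for X
    unfolding delta_C_def
    by (subst congruence_add[of _ ?n ?m])
      (use X dp dm half[OF X P] half[OF X Q] in \<open>auto simp: F_def[abs_def] delta_C_plus_def delta_C_minus_def\<close>)
  have G: "\<phi> (vertex_proj i) (\<phi> (transpose_mat \<delta>\<^sub>M\<^sup>+) (delta_C S) + \<phi> (transpose_mat \<delta>\<^sub>M\<^sup>-) (delta_C S))
     = mat_sum ?n (\<lambda>j. \<phi> (vertex_proj i) (F \<delta>\<^sub>M\<^sup>+ \<delta>\<^sub>M\<^sup>+ j + F \<delta>\<^sub>M\<^sup>- \<delta>\<^sub>M\<^sup>- j)
        + \<phi> (vertex_proj i) (F \<delta>\<^sub>M\<^sup>+ \<delta>\<^sub>M\<^sup>- j + F \<delta>\<^sub>M\<^sup>- \<delta>\<^sub>M\<^sup>+ j)) {..<length es}" for i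
  proof -
    have "\<phi> (transpose_mat \<delta>\<^sub>M\<^sup>+) (delta_C S) + \<phi> (transpose_mat \<delta>\<^sub>M\<^sup>-) (delta_C S)
      = mat_sum ?n (\<lambda>j. (F \<delta>\<^sub>M\<^sup>+ \<delta>\<^sub>M\<^sup>+ j + F \<delta>\<^sub>M\<^sup>- \<delta>\<^sub>M\<^sup>- j) + (F \<delta>\<^sub>M\<^sup>+ \<delta>\<^sub>M\<^sup>- j + F \<delta>\<^sub>M\<^sup>- \<delta>\<^sub>M\<^sup>+ j)) {..<length es}"
      (is "_ = ?R")
    proof -
      have car: "mat_sum ?n (F X Y) {..<length es} \<in> carrier_mat ?n ?n"
        if "X \<in> carrier_mat ?m ?n" "Y \<in> carrier_mat ?m ?n" for X Y
        using that by (auto intro!: mat_sum_carrier F)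
      have carR: "?R \<in> carrier_mat ?n ?n" by (rule mat_sum_carrier) (use Fs in auto)
      have dF: "dim_row (F X Y j) = ?n" "dim_col (F X Y j) = ?n"
        if "X \<in> carrier_mat ?m ?n" "Y \<in> carrier_mat ?m ?n" for X Y j
        using F[OF that, of j] by auto
      show ?thesis unfolding h[OF P] h[OF Q]
      proof (rule eq_matI, goal_cases)
        case (1 r c)
        then have rc: "r < ?n" "c < ?n" using carR by auto
        note cc = car[OF P P] car[OF P Q] car[OF Q P] car[OF Q Q]
        show ?case using rc cc
          by (simp add: carrier_matD mat_sum_index Fs dF[OF P P] dF[OF P Q] dF[OF Q P] dF[OF Q Q] sum.distrib)
      qed (use carR car[OF P P] car[OF P Q] car[OF Q P] car[OF Q Q] in auto)
    qed
    moreover have "\<phi> (vertex_proj i) ?R = mat_sum ?n (\<lambda>j. \<phi> (vertex_proj i)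
       ((F \<delta>\<^sub>M\<^sup>+ \<delta>\<^sub>M\<^sup>+ j + F \<delta>\<^sub>M\<^sup>- \<delta>\<^sub>M\<^sup>- j) + (F \<delta>\<^sub>M\<^sup>+ \<delta>\<^sub>M\<^sup>- j + F \<delta>\<^sub>M\<^sup>- \<delta>\<^sub>M\<^sup>+ j))) {..<length es}"
      by (rule congruence_sum) (use Fs B in auto)
    ultimately show ?thesis
      by (simp add: congruence_add[OF B] Fs)
  qed
  have BF: "\<phi> (vertex_proj i) (F X Y j + F X' Y' j) \<in> carrier_mat ?n ?n"
    if "X \<in> carrier_mat ?m ?n" "Y \<in> carrier_mat ?m ?n" "X' \<in> carrier_mat ?m ?n" "Y' \<in> carrier_mat ?m ?n"
    for i j X Y X' Y'
    by (rule congruence_carrier[OF B]) (use that F in auto)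
  have dBF: "dim_row (\<phi> (vertex_proj i) (F X Y j + F X' Y' j)) = ?n" "dim_col (\<phi> (vertex_proj i) (F X Y j + F X' Y' j)) = ?n"
    if "X \<in> carrier_mat ?m ?n" "Y \<in> carrier_mat ?m ?n" "X' \<in> carrier_mat ?m ?n" "Y' \<in> carrier_mat ?m ?n"
    for i j X Y X' Y'
    using BF[OF that, of i j] by auto
  have Lp: "L_C_plus S = mat_sum ?n (\<lambda>(i, j). \<phi> (vertex_proj i) (F \<delta>\<^sub>M\<^sup>+ \<delta>\<^sub>M\<^sup>+ j + F \<delta>\<^sub>M\<^sup>- \<delta>\<^sub>M\<^sup>- j))
      ({..<length vs} \<times> {..<length es})"
    by (simp add: L_C_plus_def F_def)
  have Lm: "L_C_minus S = mat_sum ?n (\<lambda>(i, j). \<phi> (vertex_proj i) (F \<delta>\<^sub>M\<^sup>+ \<delta>\<^sub>M\<^sup>- j + F \<delta>\<^sub>M\<^sup>- \<delta>\<^sub>M\<^sup>+ j))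
      ({..<length vs} \<times> {..<length es})"
    by (simp add: L_C_minus_def F_def)
  have cp: "L_C_plus S \<in> carrier_mat ?n ?n" unfolding Lp
    by (rule mat_sum_carrier) (auto intro!: BF P Q)
  have cm: "L_C_minus S \<in> carrier_mat ?n ?n" unfolding Lm
    by (rule mat_sum_carrier) (auto intro!: BF P Q)
  have inner: "mat_sum ?n (\<lambda>j. \<phi> (vertex_proj i) (F \<delta>\<^sub>M\<^sup>+ \<delta>\<^sub>M\<^sup>+ j + F \<delta>\<^sub>M\<^sup>- \<delta>\<^sub>M\<^sup>- j)
        + \<phi> (vertex_proj i) (F \<delta>\<^sub>M\<^sup>+ \<delta>\<^sub>M\<^sup>- j + F \<delta>\<^sub>M\<^sup>- \<delta>\<^sub>M\<^sup>+ j)) {..<length es} \<in> carrier_mat ?n ?n" for i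
    by (rule mat_sum_carrier) (auto intro!: add_carrier_mat BF P Q)
  have LC: "L_C S = mat_sum ?n (\<lambda>i. mat_sum ?n (\<lambda>j. \<phi> (vertex_proj i) (F \<delta>\<^sub>M\<^sup>+ \<delta>\<^sub>M\<^sup>+ j + F \<delta>\<^sub>M\<^sup>- \<delta>\<^sub>M\<^sup>- j)
        + \<phi> (vertex_proj i) (F \<delta>\<^sub>M\<^sup>+ \<delta>\<^sub>M\<^sup>- j + F \<delta>\<^sub>M\<^sup>- \<delta>\<^sub>M\<^sup>+ j)) {..<length es}) {..<length vs}"
    by (simp add: L_C_def G)
  have cL: "L_C S \<in> carrier_mat ?n ?n" unfolding LC by (rule mat_sum_carrier) (auto intro: inner)
  show ?thesis
  proof (rule eq_matI)
    fix r c assume "r < dim_row (L_C_plus S + L_C_minus S)" "c < dim_col (L_C_plus S + L_C_minus S)"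
    then have rc: "r < ?n" "c < ?n" using cm by auto
    have "L_C S $$ (r, c) = (\<Sum>i<length vs. \<Sum>j<length es.
        \<phi> (vertex_proj i) (F \<delta>\<^sub>M\<^sup>+ \<delta>\<^sub>M\<^sup>+ j + F \<delta>\<^sub>M\<^sup>- \<delta>\<^sub>M\<^sup>- j) $$ (r, c)
        + \<phi> (vertex_proj i) (F \<delta>\<^sub>M\<^sup>+ \<delta>\<^sub>M\<^sup>- j + F \<delta>\<^sub>M\<^sup>- \<delta>\<^sub>M\<^sup>+ j) $$ (r, c))"
      unfolding LC using rc inner
      by (simp add: mat_sum_index BF P Q dBF del: index_mult_mat)
    moreover have "L_C_plus S $$ (r, c) = (\<Sum>i<length vs. \<Sum>j<length es.
        \<phi> (vertex_proj i) (F \<delta>\<^sub>M\<^sup>+ \<delta>\<^sub>M\<^sup>+ j + F \<delta>\<^sub>M\<^sup>- \<delta>\<^sub>M\<^sup>- j) $$ (r, c))"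
      unfolding Lp using rc by (subst mat_sum_index) (auto simp: sum.cartesian_product BF P Q intro!: sum.cong)
    moreover have "L_C_minus S $$ (r, c) = (\<Sum>i<length vs. \<Sum>j<length es.
        \<phi> (vertex_proj i) (F \<delta>\<^sub>M\<^sup>+ \<delta>\<^sub>M\<^sup>- j + F \<delta>\<^sub>M\<^sup>- \<delta>\<^sub>M\<^sup>+ j) $$ (r, c))"
      unfolding Lm using rc by (subst mat_sum_index) (auto simp: sum.cartesian_product BF P Q intro!: sum.cong)
    ultimately show "L_C S $$ (r, c) = (L_C_plus S + L_C_minus S) $$ (r, c)"
      using rc cp cm by (simp add: sum.distrib)
  qed (use cL cp cm in auto)
qed

end

end

theory Submission
  imports Defs
begin

text \<open>
  Writing \<open>P\<close>, \<open>Q\<close> for the two halves of the coboundary, \<open>D\<close>, \<open>B\<close> for the orthogonal projections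
  onto block-diagonal matrices (over edges, respectively vertices) and \<open>a = P S P\<^sup>T\<close>, \<open>b = Q S Q\<^sup>T\<close>,
  the difference of the two Laplacian parts at \<open>S\<close> is \<open>B (P\<^sup>T D(a - b) P - Q\<^sup>T D(a - b) Q)\<close>.
  Its Frobenius inner product with the block-diagonal matrix \<open>S\<close> is
  \<open>\<langle>a - b, D (a - b)\<rangle> = \<parallel>D (a - b)\<parallel>\<^sup>2\<close>, so if it vanishes then \<open>D a = D b\<close>, which says that \<open>S\<close> lies in
  the zeroth cohomology.
\<close>

text \<open>The projection written \<open>D\<close> (edges) and \<open>B\<close> (vertices) above.
  Building it with fixed dimensions puts the result in the carrier for every argument.\<close>

definition pinching :: "nat \<Rightarrow> nat \<Rightarrow> real mat \<Rightarrow> real mat" where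
  "pinching d N X =
     mat (N * d) (N * d) (\<lambda>(r, c). if r div d = c div d then X $$ (r, c) else 0)"

definition frobenius :: "real mat \<Rightarrow> real mat \<Rightarrow> real" where
  "frobenius X Y = (\<Sum>r<dim_row X. \<Sum>c<dim_col X. X $$ (r, c) * Y $$ (r, c))"

lemma pinching_carrier [simp]: "pinching d N X \<in> carrier_mat (N * d) (N * d)"
  by (simp add: pinching_def)

lemma pinching_index:
  "r < N * d \<Longrightarrow> c < N * d \<Longrightarrow>
    pinching d N X $$ (r, c) = (if r div d = c div d then X $$ (r, c) else 0)"
  by (simp add: pinching_def)

section \<open>Block projections sum to the pinching\<close>

lemma congruence_index:
  assumes "X \<in> carrier_mat p q" "S \<in> carrier_mat q q" "r < p" "c < p"
  shows "\<phi> X S $$ (r, c) = (\<Sum>k<q. \<Sum>l<q. X $$ (r, k) * S $$ (k, l) * X $$ (c, l))"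
proof -
  have "\<phi> X S $$ (r, c) = (\<Sum>k<q. X $$ (r, k) * (\<Sum>l<q. S $$ (k, l) * X $$ (c, l)))"
    using assms by (auto simp: congruence_def scalar_prod_def lessThan_atLeast0 intro!: sum.cong)
  then show ?thesis
    by (simp add: sum_distrib_left mult.assoc)
qed

text \<open>\<open>block_proj d N i\<close> is a diagonal 0/1 matrix, so its congruence cuts out the
  \<open>i\<close>-th diagonal block.\<close>

lemma congruence_block_proj_index:
  assumes "X \<in> carrier_mat (N * d) (N * d)" "r < N * d" "c < N * d"
  shows "\<phi> (block_proj d N i) X $$ (r, c) = (if r div d = i \<and> c div d = i then X $$ (r, c) else 0)"
proof -
  have "\<phi> (block_proj d N i) X $$ (r, c) =
    (\<Sum>k<N * d. \<Sum>l<N * d. block_proj d N i $$ (r, k) * X $$ (k, l) * block_proj d N i $$ (c, l))"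
    by (rule congruence_index[OF block_proj_carrier assms])
  also have "\<dots> = (\<Sum>k<N * d. \<Sum>l<N * d.
      if k = r then if l = c then if r div d = i \<and> c div d = i then X $$ (r, c) else 0 else 0 else 0)"
    using assms(2,3) by (intro sum.cong refl) (auto simp: block_proj_index)
  also have "\<dots> = (\<Sum>k<N * d. if k = r then if r div d = i \<and> c div d = i then X $$ (r, c) else 0 else 0)"
    using assms(3) by (intro sum.cong refl) (auto simp: sum.delta)
  finally show ?thesis
    using assms(2) by (simp add: sum.delta)
qed

text \<open>Only the summand \<open>i = r div d\<close> can contribute at \<open>(r, c)\<close>, and
  it does so when \<open>c\<close> lies in the same block.\<close>

lemma sum_congruence_block_proj:
  assumes X: "X \<in> carrier_mat (N * d) (N * d)"
  shows "mat_sum (N * d) (\<lambda>i. \<phi> (block_proj d N i) X) {..<N} = pinching d N X"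
proof -
  have car: "\<phi> (block_proj d N i) X \<in> carrier_mat (N * d) (N * d)" for i
    by (rule congruence_carrier[OF block_proj_carrier X])
  have car': "mat_sum (N * d) (\<lambda>i. \<phi> (block_proj d N i) X) {..<N} \<in> carrier_mat (N * d) (N * d)"
    by (rule mat_sum_carrier) (use car in auto)
  show ?thesis
  proof (rule eq_matI)
    fix r c assume "r < dim_row (pinching d N X)" "c < dim_col (pinching d N X)"
    then have rc: "r < N * d" "c < N * d" by (auto simp: pinching_def)
    have "r div d < N" using rc by (simp add: less_mult_imp_div_less)
    have "(\<Sum>i<N. \<phi> (block_proj d N i) X $$ (r, c)) =
      (\<Sum>i<N. if i = r div d then if r div d = c div d then X $$ (r, c) else 0 else 0)"
      by (intro sum.cong refl) (auto simp: congruence_block_proj_index[OF X rc])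
    with rc \<open>r div d < N\<close>
    show "mat_sum (N * d) (\<lambda>i. \<phi> (block_proj d N i) X) {..<N} $$ (r, c) = pinching d N X $$ (r, c)"
      by (simp add: mat_sum_index car pinching_index)
  qed (use car' in \<open>auto simp: pinching_def\<close>)
qed

section \<open>Closed form of the Laplacian parts\<close>

lemma mat_sum_add:
  assumes "finite I" "\<And>i. i \<in> I \<Longrightarrow> f i \<in> carrier_mat N N" "\<And>i. i \<in> I \<Longrightarrow> g i \<in> carrier_mat N N"
  shows "mat_sum N (\<lambda>i. f i + g i) I = mat_sum N f I + mat_sum N g I"
proof -
  interpret abelian_group "module_mat TYPE(real) N N" by (rule abelian_group_mat)
  show ?thesis using finsum_addf[of f I g] assms by (auto simp: module_mat_simps)
qed

lemma mat_sum_Times: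
  assumes "finite I" "finite J" "\<And>i j. i \<in> I \<Longrightarrow> j \<in> J \<Longrightarrow> f i j \<in> carrier_mat N N"
  shows "mat_sum N (\<lambda>(i, j). f i j) (I \<times> J) = mat_sum N (\<lambda>i. mat_sum N (f i) J) I"
proof -
  have 1: "mat_sum N (\<lambda>(i, j). f i j) (I \<times> J) \<in> carrier_mat N N"
    by (rule mat_sum_carrier) (use assms in auto)
  have 2: "i \<in> I \<Longrightarrow> mat_sum N (f i) J \<in> carrier_mat N N" for i
    by (rule mat_sum_carrier) (use assms in auto)
  have 3: "mat_sum N (\<lambda>i. mat_sum N (f i) J) I \<in> carrier_mat N N"
    by (rule mat_sum_carrier) (use assms 2 in auto)
  show ?thesis
  proof (rule eq_matI)
    fix r c assume "r < dim_row (mat_sum N (\<lambda>i. mat_sum N (f i) J) I)"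
      "c < dim_col (mat_sum N (\<lambda>i. mat_sum N (f i) J) I)"
    then have rc: "r < N" "c < N" using 3 by auto
    have "mat_sum N (\<lambda>(i, j). f i j) (I \<times> J) $$ (r, c) = (\<Sum>(i, j)\<in>I \<times> J. f i j $$ (r, c))"
      using assms rc by (subst mat_sum_index) (auto intro!: sum.cong)
    also have "\<dots> = mat_sum N (\<lambda>i. mat_sum N (f i) J) I $$ (r, c)"
      using assms rc 2 by (simp add: mat_sum_index sum.cartesian_product[symmetric])
    finally show "mat_sum N (\<lambda>(i, j). f i j) (I \<times> J) $$ (r, c)
      = mat_sum N (\<lambda>i. mat_sum N (f i) J) I $$ (r, c)" .
  qed (use 1 3 in auto)
qed

text \<open>Congruence turns products into compositions and is additive, so the sum over
  \<open>j\<close> moves inside to the block projections.\<close>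

lemma sum_congruence_sandwich:
  assumes X: "X \<in> carrier_mat (m * d) n" and Y: "Y \<in> carrier_mat (m * d) n"
    and S: "S \<in> carrier_mat n n"
  shows "mat_sum n (\<lambda>j. \<phi> (transpose_mat X * block_proj d m j * Y) S) {..<m} =
    \<phi> (transpose_mat X) (pinching d m (\<phi> Y S))"
proof -
  note A = block_proj_carrier[of d m]
  note YS = congruence_carrier[OF Y S]
  have "\<phi> (transpose_mat X * block_proj d m j * Y) S =
      \<phi> (transpose_mat X) (\<phi> (block_proj d m j) (\<phi> Y S))" for j
  proof -
    have "\<phi> (transpose_mat X * block_proj d m j * Y) S = \<phi> (transpose_mat X * block_proj d m j) (\<phi> Y S)"
      by (rule congruence_congruence[symmetric, of _ n "m * d" _ n]) (use X Y A S in auto)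
    also have "\<dots> = \<phi> (transpose_mat X) (\<phi> (block_proj d m j) (\<phi> Y S))"
      by (rule congruence_congruence[symmetric, of _ n "m * d" _ "m * d"]) (use X A YS in auto)
    finally show ?thesis .
  qed
  moreover have "\<phi> (transpose_mat X) (mat_sum (m * d) (\<lambda>j. \<phi> (block_proj d m j) (\<phi> Y S)) {..<m}) =
      mat_sum n (\<lambda>j. \<phi> (transpose_mat X) (\<phi> (block_proj d m j) (\<phi> Y S))) {..<m}"
    by (rule congruence_sum) (use X in \<open>auto intro!: congruence_carrier[OF A] YS\<close>)
  ultimately show ?thesis
    by (simp add: sum_congruence_block_proj[OF YS])
qed

text \<open>Four independent matrices let one formula serve both parts: \<open>L_C_plus\<close> has
  \<open>X = Y\<close> and \<open>X' = Y'\<close>, \<open>L_C_minus\<close> has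
  \<open>X' = Y\<close> and \<open>Y' = X\<close>.\<close>

lemma sum_vertex_edge_congruences:
  assumes X: "X \<in> carrier_mat (m * d) (n * d)" and Y: "Y \<in> carrier_mat (m * d) (n * d)"
    and X': "X' \<in> carrier_mat (m * d) (n * d)" and Y': "Y' \<in> carrier_mat (m * d) (n * d)"
    and S: "S \<in> carrier_mat (n * d) (n * d)"
  shows "mat_sum (n * d) (\<lambda>(i, j). \<phi> (block_proj d n i)
      (\<phi> (transpose_mat X * block_proj d m j * Y) S + \<phi> (transpose_mat X' * block_proj d m j * Y') S))
      ({..<n} \<times> {..<m}) =
    pinching d n (\<phi> (transpose_mat X) (pinching d m (\<phi> Y S)) + \<phi> (transpose_mat X') (pinching d m (\<phi> Y' S)))"
proof -
  let ?F = "\<lambda>X Y j. \<phi> (transpose_mat X * block_proj d m j * Y) S"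
  note A = block_proj_carrier[of d m]
  note B = block_proj_carrier[of d n]
  have F: "?F X Y j \<in> carrier_mat (n * d) (n * d)" "?F X' Y' j \<in> carrier_mat (n * d) (n * d)" for j
    by (rule congruence_carrier[of _ _ "n * d"]; use X Y X' Y' A S in auto)+
  have G: "\<phi> (transpose_mat X) (pinching d m (\<phi> Y S)) + \<phi> (transpose_mat X') (pinching d m (\<phi> Y' S))
      \<in> carrier_mat (n * d) (n * d)"
    using X X' by (auto intro!: add_carrier_mat congruence_carrier[of _ _ "m * d"])
  have "mat_sum (n * d) (\<lambda>j. \<phi> (block_proj d n i) (?F X Y j + ?F X' Y' j)) {..<m} =
      \<phi> (block_proj d n i) (mat_sum (n * d) (\<lambda>j. ?F X Y j + ?F X' Y' j) {..<m})" for i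
    by (rule congruence_sum[symmetric, OF B]) (use F in auto)
  then show ?thesis
    using F X Y X' Y' S
    by (subst mat_sum_Times)
      (auto intro!: congruence_carrier[OF B] simp: mat_sum_add sum_congruence_sandwich
        sum_congruence_block_proj[OF G])
qed

section \<open>The Frobenius pairing\<close>

text \<open>Adjointness of congruence by \<open>X\<close> and by its transpose: both sides are the
  same fourfold sum in a different order.\<close>

lemma frobenius_congruence:
  assumes X: "X \<in> carrier_mat p q" and S: "S \<in> carrier_mat q q" and T: "T \<in> carrier_mat p p"
  shows "frobenius S (\<phi> (transpose_mat X) T) = frobenius (\<phi> X S) T"
proof -
  let ?t = "\<lambda>k l r c. S $$ (k, l) * X $$ (r, k) * T $$ (r, c) * X $$ (c, l)"
  have "frobenius S (\<phi> (transpose_mat X) T) = (\<Sum>k<q. \<Sum>l<q. \<Sum>r<p. \<Sum>c<p. ?t k l r c)"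
    using assms by (auto simp: frobenius_def congruence_index[of _ q p] sum_distrib_left mult.assoc
        intro!: sum.cong)
  also have "\<dots> = (\<Sum>r<p. \<Sum>c<p. \<Sum>k<q. \<Sum>l<q. ?t k l r c)"
    \<comment> \<open>Fixing both index sets orients the exchange: sums over \<open>q\<close> move
      outwards, which brings the right-hand side to the form of the left.\<close>
    by (simp only: sum.swap[where A = "{..<p}" and B = "{..<q}"])
  also have "\<dots> = frobenius (\<phi> X S) T"
    using congruence_carrier[OF X S] congruence_index[OF X S]
    by (auto simp: frobenius_def sum_distrib_left sum_distrib_right ac_simps intro!: sum.cong)
  finally show ?thesis .
qed

lemma frobenius_add_right:
  assumes "S \<in> carrier_mat n n" "X \<in> carrier_mat n n" "Y \<in> carrier_mat n n"
  shows "frobenius S (X + Y) = frobenius S X + frobenius S Y"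
  using assms by (simp add: frobenius_def sum.distrib distrib_left)

lemma frobenius_pinching:
  assumes "S \<in> carrier_mat (N * d) (N * d)"
  shows "frobenius S (pinching d N X) = frobenius (pinching d N S) (pinching d N X)"
  using assms by (auto simp: frobenius_def pinching_index pinching_def intro!: sum.cong)

text \<open>The off-block entries of \<open>X\<close> meet zeros of \<open>S\<close>. This removes
  the outer vertex projection of the Laplacian.\<close>

lemma frobenius_pinching_left:
  assumes "pinching d N S = S"
  shows "frobenius S (pinching d N X) = frobenius S X"
proof -
  have "frobenius (pinching d N S) (pinching d N X) = frobenius (pinching d N S) X"
    by (auto simp: frobenius_def pinching_index pinching_def intro!: sum.cong)
  then show ?thesis by (simp add: assms)
qed

text \<open>The hypothesis is the expanded form of "the squared norm of \<open>X - Y\<close> is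
  zero".\<close>

lemma frobenius_polarization_eq:
  assumes X: "X \<in> carrier_mat n n" and Y: "Y \<in> carrier_mat n n"
    and eq: "frobenius X X + frobenius Y Y = frobenius X Y + frobenius Y X"
  shows "X = Y"
proof -
  have "(\<Sum>r<n. \<Sum>c<n. (X $$ (r, c) - Y $$ (r, c))\<^sup>2)
      = (frobenius X X + frobenius Y Y) - (frobenius X Y + frobenius Y X)"
    using X Y by (simp add: frobenius_def power2_eq_square algebra_simps sum.distrib sum_subtractf sum_distrib_left)
  then have "(\<Sum>r<n. \<Sum>c<n. (X $$ (r, c) - Y $$ (r, c))\<^sup>2) = 0"
    by (simp add: eq)
  then have "\<forall>r<n. \<forall>c<n. X $$ (r, c) = Y $$ (r, c)"
    by (auto simp: sum_nonneg_eq_0_iff sum_nonneg)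
  with X Y show ?thesis by (intro eq_matI) auto
qed

section \<open>Cochains are fixed by the pinching\<close>

lemma diag_block_mat_carrier:
  "\<forall>A\<in>set As. A \<in> carrier_mat d d \<Longrightarrow>
    diag_block_mat As \<in> carrier_mat (length As * d) (length As * d)"
  by (induction As) (auto simp: Let_def)

lemma diag_block_mat_index_off_diagonal:
  assumes "\<forall>A\<in>set As. A \<in> carrier_mat d d"
    and "r < length As * d" "c < length As * d" "r div d \<noteq> c div d"
  shows "diag_block_mat As $$ (r, c) = 0"
  using assms
proof (induction As arbitrary: r c)
  case (Cons A As)
  let ?D = "diag_block_mat As"
  have D: "?D \<in> carrier_mat (length As * d) (length As * d)"
    using Cons.prems(1) by (intro diag_block_mat_carrier) simp
  have A: "A \<in> carrier_mat d d" using Cons.prems(1) by simp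
  have "d > 0" using Cons.prems(2) by (cases d) auto
  \<comment> \<open>The blocks differ, so in the first two cases exactly one index is in the first
    block and the entry lies in a zero block. In the third, dropping a block lowers both block
    numbers by one and keeps them distinct.\<close>
  consider "r < d" | "c < d" | "d \<le> r" "d \<le> c" by linarith
  then show ?case
  proof cases
    case 3
    with \<open>d > 0\<close> Cons.prems have "?D $$ (r - d, c - d) = 0"
      by (intro Cons.IH) (auto simp: le_div_geq)
    with 3 D A Cons.prems(2,3) show ?thesis by (simp add: Let_def)
  qed (use D A Cons.prems in \<open>auto simp: Let_def\<close>)
qed simp

lemma pinching_block_cone:
  assumes "S \<in> block_cone d N"
  shows "S \<in> carrier_mat (N * d) (N * d)" "pinching d N S = S"
proof -
  obtain X where X: "\<forall>i<N. X i \<in> psd_cone d" and S: "S = diag_block_mat (map X [0..<N])"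
    using assms by (auto simp: block_cone_def)
  have X': "\<forall>A\<in>set (map X [0..<N]). A \<in> carrier_mat d d"
    using X by (auto simp: psd_cone_def)
  from diag_block_mat_carrier[OF X'] show car: "S \<in> carrier_mat (N * d) (N * d)"
    by (simp add: S)
  have "S $$ (r, c) = 0" if "r < N * d" "c < N * d" "r div d \<noteq> c div d" for r c
    unfolding S by (rule diag_block_mat_index_off_diagonal[OF X']) (use that in auto)
  then show "pinching d N S = S"
    using car by (intro eq_matI) (auto simp: pinching_def)
qed

theorem theorem3p2:
  fixes G :: "'v pair_pre_digraph"
    and vs :: "'v list" and es :: "('v \<times> 'v) list"
    and d :: nat and M :: "'v \<Rightarrow> 'v set \<Rightarrow> real mat"
  assumes "pair_graph G"
    and "Digraph_Component.connected (with_proj G)"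
    and "vertex_enumeration G vs"
    and "oriented_edge_enumeration G es"
    and "sheaf_of_means G d M"
    and "invertible_restrictions G M"
  shows "equalizer (C0 vs d) (L_C_plus vs es d M) (L_C_minus vs es d M) = H0 vs es d M"
proof -
  let ?n = "length vs" and ?m = "length es"
  let ?P = "delta_M_plus vs es d M" and ?Q = "delta_M_minus vs es d M"
  have P: "?P \<in> carrier_mat (?m * d) (?n * d)" and Q: "?Q \<in> carrier_mat (?m * d) (?n * d)"
    by (simp_all add: delta_M_plus_def delta_M_minus_def half_coboundary_carrier)
  have "L_C_plus vs es d M S = L_C_minus vs es d M S \<longleftrightarrow>
      delta_C_plus vs es d M S = delta_C_minus vs es d M S" if "S \<in> C0 vs d" for S
  proof -
    have S: "S \<in> carrier_mat (?n * d) (?n * d)" and pS: "pinching d ?n S = S"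
      using pinching_block_cone that by (auto simp: C0_def)
    define a where "a = pinching d ?m (\<phi> ?P S)"
    define b where "b = pinching d ?m (\<phi> ?Q S)"
    let ?P' = "\<phi> (transpose_mat ?P)" and ?Q' = "\<phi> (transpose_mat ?Q)"
    note PS = congruence_carrier[OF P S] and QS = congruence_carrier[OF Q S]
    have ab: "a \<in> carrier_mat (?m * d) (?m * d)" "b \<in> carrier_mat (?m * d) (?m * d)"
      by (simp_all add: a_def b_def)
    have delta: "delta_C_plus vs es d M S = a" "delta_C_minus vs es d M S = b"
      by (simp_all add: delta_C_plus_def delta_C_minus_def a_def b_def
          sum_congruence_block_proj PS QS)
    have L: "L_C_plus vs es d M S = pinching d ?n (?P' a + ?Q' b)"
      "L_C_minus vs es d M S = pinching d ?n (?P' b + ?Q' a)"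
      by (simp_all add: L_C_plus_def L_C_minus_def a_def b_def sum_vertex_edge_congruences P Q S)
    \<comment> \<open>The pair \<open>x = a\<close>, \<open>y = b\<close> gives the pairing of
      \<open>S\<close> with \<open>L_C_plus\<close>, the swapped pair that with
      \<open>L_C_minus\<close>.\<close>
    have energy: "frobenius S (pinching d ?n (?P' x + ?Q' y)) = frobenius a x + frobenius b y"
      if "x \<in> {a, b}" "y \<in> {a, b}" for x y
    proof -
      have xy: "x \<in> carrier_mat (?m * d) (?m * d)" "y \<in> carrier_mat (?m * d) (?m * d)"
        using that ab by auto
      have "frobenius S (pinching d ?n (?P' x + ?Q' y)) = frobenius S (?P' x + ?Q' y)"
        by (rule frobenius_pinching_left[OF pS])
      also have "\<dots> = frobenius S (?P' x) + frobenius S (?Q' y)"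
        by (rule frobenius_add_right[OF S])
          (use P Q xy in \<open>auto intro!: congruence_carrier[of _ _ "?m * d"]\<close>)
      also have "\<dots> = frobenius (\<phi> ?P S) x + frobenius (\<phi> ?Q S) y"
        using frobenius_congruence[OF P S xy(1)] frobenius_congruence[OF Q S xy(2)] by simp
      \<comment> \<open>Both \<open>x\<close> and \<open>y\<close> are pinchings themselves, so the
        first arguments may be pinched too.\<close>
      also have "\<dots> = frobenius a x + frobenius b y"
        using that frobenius_pinching[OF PS] frobenius_pinching[OF QS] by (auto simp: a_def b_def)
      finally show ?thesis .
    qed
    show ?thesis unfolding delta
    proof
      assume "L_C_plus vs es d M S = L_C_minus vs es d M S"
      then have "frobenius a a + frobenius b b = frobenius a b + frobenius b a"
        using energy[of a b] energy[of b a] by (simp add: L)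
      then show "a = b" by (rule frobenius_polarization_eq[OF ab])
    \<comment> \<open>Conversely, \<open>a = b\<close> makes the two right-hand sides of
      \<open>L\<close> identical.\<close>
    qed (simp add: L)
  qed
  then show ?thesis by (auto simp: H0_def equalizer_def)
qed

end
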